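(* For all $n,k\in\mathbb{Z}$, $\left|\mathcal{A}_{\{001,210\}}(n+1,k)\right|=R_{n,k}$, where $\mathcal{A}_{\{001,210\}}(n+1,k)$ is the set of ascent sequences of length $n+1$ that avoid both patterns $001$ and $210$ and have exactly $k$ ascents, and $R_{n,k}$ is the Rascal number.
   Context: The Rascal numbers $R_{n,k}$ ($n,k\in\mathbb{Z}$) are defined by: $R_{n,k}=0$ whenever $k>n$, $n<0$, or $k<0$; $R_{n,0}=R_{n,n}=1$ for all $n\ge 0$; and $R_{n,k}=\dfrac{R_{n-1,k}R_{n-1,k-1}+1}{R_{n-2,k-1}}$ for $n\ge 2$ and $1\le k\le n-1$. For a word $w=w_1\cdots w_n$ of nonnegative integers, $\operatorname{asc}(w)$ is the number of indices $1\le i\le n-1$ with $w_i<w_{i+1}$. An ascent sequence of length $n$ is a word $w=w_1\cdots w_n$ of nonnegative integers such that $w_1=0$ and $w_i\le \operatorname{asc}(w_1\cdots w_{i-1})+1$ for $1<i\le n$; since $w_1=0$ is required, ascent sequences have length at least $1$ (there are none of length $\le 0$). The reduction $\operatorname{red}(w)$ of a word is obtained by replacing every occurrence of the $i$-th smallest distinct letter of $w$ by $i-1$. A word $w$ contains a pattern $p=p_1\cdots p_m$ if there are indices $1\le i_1<\cdots<i_m\le n$ with $\operatorname{red}(w_{i_1}\cdots w_{i_m})=p$; otherwise $w$ avoids $p$. $\mathcal{A}_{\{001,210\}}(n,k)$ is the set of ascent sequences $w$ of length $n$ that avoid both $001$ and $210$ and satisfy $\operatorname{asc}(w)=k$. 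*)

theory Defs
  imports Complex_Main
begin

text \<open>The values are taken in the rationals, so that the division in the recurrence is exact division;
  that all values are integers is not presupposed.\<close>

function rascal :: "int \<Rightarrow> int \<Rightarrow> rat" where
  "rascal n k =
    (if k > n \<or> n < 0 \<or> k < 0 then 0
     else if k = 0 \<or> k = n then 1
     else (rascal (n - 1) k * rascal (n - 1) (k - 1) + 1) / rascal (n - 2) (k - 1))"
  by pat_completeness auto
termination
  by (relation "measure (\<lambda>(n, k). nat n)") auto

declare rascal.simps [simp del]

lemma rascal_eq_0: "k > n \<or> n < 0 \<or> k < 0 \<Longrightarrow> rascal n k = 0"
  by (subst rascal.simps) auto

lemma rascal_0_right: "n \<ge> 0 \<Longrightarrow> rascal n 0 = 1"
  by (subst rascal.simps) auto

lemma rascal_self: "n \<ge> 0 \<Longrightarrow> rascal n n = 1"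
  by (subst rascal.simps) auto

lemma rascal_rec:
  assumes "n \<ge> 2" and "1 \<le> k" and "k \<le> n - 1"
  shows "rascal n k = (rascal (n - 1) k * rascal (n - 1) (k - 1) + 1) / rascal (n - 2) (k - 1)"
  using assms by (subst rascal.simps) auto

lemma rascal_pos: "0 \<le> k \<Longrightarrow> k \<le> n \<Longrightarrow> rascal n k > 0"
proof (induction n k rule: rascal.induct)
  case (1 n k)
  show ?case
  proof (cases "k = 0 \<or> k = n")
    case True
    with 1 show ?thesis by (auto simp: rascal_0_right rascal_self)
  next
    case False
    with 1 have "rascal (n - 1) k > 0" "rascal (n - 1) (k - 1) > 0" "rascal (n - 2) (k - 1) > 0"
      by auto
    with False 1(4,5) show ?thesis
      by (subst rascal_rec) (auto intro!: divide_pos_pos add_pos_pos)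
  qed
qed

text \<open>Words are lists, hence indexed from 0.\<close>

definition asc :: "nat list \<Rightarrow> nat" where
  "asc w = card {i. Suc i < length w \<and> w ! i < w ! Suc i}"

definition ascent_seq :: "nat list \<Rightarrow> bool" where
  "ascent_seq w \<longleftrightarrow> w \<noteq> [] \<and> w ! 0 = 0 \<and>
     (\<forall>i. 0 < i \<and> i < length w \<longrightarrow> w ! i \<le> asc (take i w) + 1)"

text \<open>If \<open>x\<close> is the \<open>i\<close>-th smallest distinct letter of \<open>w\<close>, then exactly \<open>i - 1\<close> distinct
  letters of \<open>w\<close> are smaller than \<open>x\<close>.\<close>

definition red :: "nat list \<Rightarrow> nat list" where
  "red w = map (\<lambda>x. card {y \<in> set w. y < x}) w"

definition contains_pattern :: "nat list \<Rightarrow> nat list \<Rightarrow> bool" where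
  "contains_pattern w p \<longleftrightarrow> (\<exists>I \<subseteq> {..<length w}. red (nths w I) = p)"

definition ascent_avoiders :: "nat list set \<Rightarrow> int \<Rightarrow> int \<Rightarrow> nat list set" where
  "ascent_avoiders P n k =
     {w. ascent_seq w \<and> int (length w) = n \<and> (\<forall>p\<in>P. \<not> contains_pattern w p) \<and> int (asc w) = k}"

lemma asc_le_length: "asc w \<le> length w"
proof -
  have "card {i. Suc i < length w \<and> w ! i < w ! Suc i} \<le> card {..<length w}"
    by (rule card_mono) auto
  then show ?thesis by (simp add: asc_def)
qed

text \<open>Finiteness, so that \<^const>\<open>card\<close> is the actual cardinality of these sets.\<close>

lemma finite_ascent_avoiders: "finite (ascent_avoiders P n k)"
proof (rule finite_subset)
  show "ascent_avoiders P n k \<subseteq> {w. set w \<subseteq> {..nat n} \<and> length w = nat n}"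
  proof safe
    fix w x assume w: "w \<in> ascent_avoiders P n k" and "x \<in> set w"
    then obtain i where i: "i < length w" "x = w ! i" by (auto simp: in_set_conv_nth)
    show "x \<le> nat n"
    proof (cases "i = 0")
      case True
      with w i show ?thesis by (auto simp: ascent_avoiders_def ascent_seq_def)
    next
      case False
      with w i have "x \<le> asc (take i w) + 1" by (auto simp: ascent_avoiders_def ascent_seq_def)
      with asc_le_length[of "take i w"] i w show ?thesis by (auto simp: ascent_avoiders_def)
    qed
  qed (auto simp: ascent_avoiders_def)
  show "finite {w. set w \<subseteq> {..nat n} \<and> length w = nat n}"
    by (rule finite_lists_length_eq) simp
qed

end

theory Submission
  imports Defs "HOL-Library.Sublist"
begin

text \<open>The letters of an ascent sequence avoiding \<open>001\<close> increase by one up to some value \<open>m\<close>. The first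
  letter that fails to do so is at most \<open>m\<close>, so it and every later letter repeat an earlier
  letter, and avoidance of \<open>001\<close> makes the rest of the word weakly decreasing. Hence
  \<open>w = 0 1 \<dots> m t\<close> with \<open>t\<close> weakly decreasing and \<open>m = asc w\<close>. If \<open>t\<close> has a descent from
  a letter below \<open>m\<close>, then \<open>m\<close> completes it to a \<open>210\<close>; so \<open>t\<close> is a block of letters \<open>m\<close> followed
  by a block of one smaller letter \<open>y\<close>. The choice of \<open>y < m\<close> and of the positive length of the
  last block, together with the case of an empty last block, gives \<open>m (n - m) + 1\<close> words of length
  \<open>n + 1\<close>, which is the closed form of the Rascal numbers.\<close>

section \<open>Closed form of the Rascal numbers\<close>

lemma rascal_closed_form:
  assumes "0 \<le> k" and "k \<le> n"
  shows "rascal n k = of_int (k * (n - k) + 1)"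
  using assms
proof (induction n k rule: rascal.induct)
  case (1 n k)
  show ?case
  proof (cases "k = 0 \<or> k = n")
    case True
    with 1 show ?thesis by (auto simp: rascal_0_right rascal_self)
  next
    case False
    with 1 have k: "1 \<le> k" "k \<le> n - 1" by auto
    with 1 False have IH:
      "rascal (n - 1) k = of_int (k * (n - 1 - k) + 1)"
      "rascal (n - 1) (k - 1) = of_int ((k - 1) * (n - k) + 1)"
      "rascal (n - 2) (k - 1) = of_int ((k - 1) * (n - 1 - k) + 1)"
      by auto
    have "(k - 1) * (n - 1 - k) \<ge> 0" using k by simp
    then have nz: "(of_int ((k - 1) * (n - 1 - k) + 1) :: rat) \<noteq> 0"
      by (subst of_int_eq_0_iff) linarith
    have "rascal n k = (rascal (n - 1) k * rascal (n - 1) (k - 1) + 1) / rascal (n - 2) (k - 1)"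
      using k by (intro rascal_rec) auto
    \<comment> \<open>With a = k and b = n - k this is the identity (ab - a + 1)(ab - b + 1) + 1 =
      (ab + 1)(ab - a - b + 2), whose last factor is the denominator.\<close>
    also have "\<dots> = of_int (k * (n - k) + 1)"
      unfolding IH nonzero_divide_eq_eq[OF nz] by (simp add: algebra_simps)
    finally show ?thesis .
  qed
qed

section \<open>Ascents when a letter is appended\<close>

lemma asc_singleton [simp]: "asc [x] = 0"
  by (simp add: asc_def)

lemma asc_snoc:
  assumes "w \<noteq> []"
  shows "asc (w @ [x]) = asc w + (if last w < x then 1 else 0)"
proof -
  let ?A = "{i. Suc i < length w \<and> w ! i < w ! Suc i}"
  \<comment> \<open>At most one new ascent arises, at the junction of \<open>w\<close> and
    \<open>x\<close>; as a set it is disjoint from the old ascents.\<close>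
  let ?B = "{i. Suc i = length w \<and> last w < x}"
  have last: "w ! i = last w" if "Suc i = length w" for i
    using that assms by (simp add: last_conv_nth flip: that)
  have "?B = (if last w < x then {length w - 1} else {})"
    using assms by auto
  then have "card ?B = (if last w < x then 1 else 0)" by simp
  have "{i. Suc i < length (w @ [x]) \<and> (w @ [x]) ! i < (w @ [x]) ! Suc i} = ?A \<union> ?B"
    by (auto simp: nth_append last less_Suc_eq)
  moreover have "card (?A \<union> ?B) = card ?A + card ?B"
    using assms by (intro card_Un_disjoint) (auto intro: finite_subset[of _ "{..<length w}"])
  ultimately show ?thesis using \<open>card ?B = _\<close> by (simp only: asc_def)
qed

lemma ascent_seq_snoc:
  assumes "w \<noteq> []"
  shows "ascent_seq (w @ [x]) \<longleftrightarrow> ascent_seq w \<and> x \<le> asc w + 1"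
  using assms by (auto simp: ascent_seq_def nth_append less_Suc_eq all_conj_distrib)

lemma asc_less_length: "w \<noteq> [] \<Longrightarrow> asc w < length w"
  by (induction w rule: rev_nonempty_induct) (auto simp: asc_snoc)

lemma asc_upt: "asc [0..<Suc m] = m"
proof (induction m)
  case (Suc m)
  have "asc ([0..<Suc m] @ [Suc m]) = asc [0..<Suc m] + (if last [0..<Suc m] < Suc m then 1 else 0)"
    by (rule asc_snoc) simp
  moreover have "last [0..<Suc m] < Suc m" by simp
  ultimately show ?case using Suc by simp
qed simp

text \<open>Putting \<open>m\<close> in front of \<open>t\<close> in the hypothesis also bounds the
  first letter of \<open>t\<close>, so the junction with the run is no ascent.\<close>

lemma asc_upt_append:
  "sorted_wrt (\<ge>) (m # t) \<Longrightarrow> asc ([0..<Suc m] @ t) = m"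
proof (induction t rule: rev_induct)
  case Nil
  then show ?case by (simp add: asc_upt del: upt_Suc)
next
  case (snoc x t)
  have "x \<le> last ([0..<Suc m] @ t)"
    using snoc.prems by (cases t rule: rev_cases) (auto simp: sorted_wrt_append)
  with snoc asc_snoc[of "[0..<Suc m] @ t" x] show ?case
    by (simp add: sorted_wrt_append)
qed

lemma ascent_seq_upt_append:
  "sorted_wrt (\<ge>) (m # t) \<Longrightarrow> ascent_seq ([0..<Suc m] @ t)"
proof (induction t rule: rev_induct)
  case Nil
  show ?case by (auto simp: ascent_seq_def asc_upt take_upt
        less_Suc_eq_0_disj simp del: upt_Suc)
next
  case (snoc x t)
  then have "sorted_wrt (\<ge>) (m # t)" "x \<le> m" by (auto simp: sorted_wrt_append)
  with snoc.IH asc_upt_append[of m t] ascent_seq_snoc[of "[0..<Suc m] @ t" x]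
  show ?case by simp
qed

section \<open>Pattern containment by subsequences\<close>

lemma contains_pattern_iff_subseq:
  "contains_pattern w p \<longleftrightarrow> (\<exists>v. subseq v w \<and> red v = p)"
proof -
  \<comment> \<open>Indices beyond the word select nothing, so arbitrary index sets give the same
    subwords as bounded ones.\<close>
  have "nths w N = nths w (N \<inter> {..<length w})" for N
    unfolding nths_def by (rule arg_cong[of _ _ "map fst"], rule filter_cong)
      (auto simp: in_set_zip)
  then show ?thesis
    unfolding contains_pattern_def subseq_conv_nths by (metis inf_le2)
qed

text \<open>If \<open>x < y\<close> then \<open>x\<close> itself is counted for \<open>y\<close> but
  not for \<open>x\<close>, which is where membership of \<open>x\<close> enters; otherwise the
  letters below \<open>y\<close> are among those below \<open>x\<close>.\<close>

lemma red_eq_map_order: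
  obtains r where "red v = map r v"
    and "\<And>x y. x \<in> set v \<Longrightarrow> r x < r y \<longleftrightarrow> x < y"
proof
  define r where "r = (\<lambda>x. card {z \<in> set v. z < x})"
  show "red v = map r v" by (simp add: red_def r_def)
  show "r x < r y \<longleftrightarrow> x < y" if "x \<in> set v" for x y
  proof
    assume "x < y"
    with that have "{z \<in> set v. z < x} \<subset> {z \<in> set v. z < y}" by force
    then show "r x < r y" unfolding r_def by (intro psubset_card_mono) auto
  next
    assume *: "r x < r y"
    show "x < y"
    proof (rule ccontr)
      assume "\<not> x < y"
      then have "r y \<le> r x" unfolding r_def by (intro card_mono) auto
      with * show False by simp
    qed
  qed
qed

lemma red_001_iff: "red v = [0, 0, 1] \<longleftrightarrow> (\<exists>a b. a < b \<and> v = [a, a, b])"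
proof
  assume *: "red v = [0, 0, 1]"
  obtain r where r: "red v = map r v" "\<And>x y. x \<in> set v \<Longrightarrow> r x < r y \<longleftrightarrow> x < y"
    using red_eq_map_order[of v] by metis
  from * r(1) obtain a b c where v: "v = [a, b, c]" "r a = 0" "r b = 0" "r c = 1"
    by auto
  with r(2)[of a b] r(2)[of b a] r(2)[of a c] have "a = b" "a < c" by auto
  with v(1) show "\<exists>a b. a < b \<and> v = [a, a, b]" by blast
next
  assume "\<exists>a b. a < b \<and> v = [a, a, b]"
  then obtain a b where "a < b" and v: "v = [a, a, b]" by blast
  then have "{y. (y = a \<or> y = b) \<and> y < a} = {}" "{y. (y = a \<or> y = b) \<and> y < b} = {a}"
    by auto
  then show "red v = [0, 0, 1]" unfolding v by (simp add: red_def)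
qed

lemma red_210_iff: "red v = [2, 1, 0] \<longleftrightarrow> (\<exists>a b c. a < b \<and> b < c \<and> v = [c, b, a])"
proof
  assume *: "red v = [2, 1, 0]"
  obtain r where r: "red v = map r v" "\<And>x y. x \<in> set v \<Longrightarrow> r x < r y \<longleftrightarrow> x < y"
    using red_eq_map_order[of v] by metis
  from * r(1) obtain a b c where v: "v = [c, b, a]" "r c = 2" "r b = 1" "r a = 0"
    by auto
  with r(2)[of a b] r(2)[of b c] have "a < b" "b < c" by auto
  with v(1) show "\<exists>a b c. a < b \<and> b < c \<and> v = [c, b, a]" by blast
next
  assume "\<exists>a b c. a < b \<and> b < c \<and> v = [c, b, a]"
  then obtain a b c where "a < b" "b < c" and v: "v = [c, b, a]" by blast
  then have "{y. (y = c \<or> y = b \<or> y = a) \<and> y < a} = {}"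
    "{y. (y = c \<or> y = b \<or> y = a) \<and> y < b} = {a}"
    "{y. (y = c \<or> y = b \<or> y = a) \<and> y < c} = {a, b}"
    by auto
  with \<open>a < b\<close> show "red v = [2, 1, 0]" unfolding v by (simp add: red_def)
qed

lemma contains_001_iff:
  "contains_pattern w [0, 0, 1] \<longleftrightarrow> (\<exists>a b. a < b \<and> subseq [a, a, b] w)"
  unfolding contains_pattern_iff_subseq red_001_iff by blast

lemma contains_210_iff:
  "contains_pattern w [2, 1, 0] \<longleftrightarrow> (\<exists>a b c. a < b \<and> b < c \<and> subseq [c, b, a] w)"
  unfolding contains_pattern_iff_subseq red_210_iff by blast

section \<open>Structure of the avoiding ascent sequences\<close>

lemma sorted_wrt_subseq: "subseq xs ys \<Longrightarrow> sorted_wrt P ys \<Longrightarrow> sorted_wrt P xs"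
  by (induction rule: list_emb.induct) (auto dest: list_emb_set)

lemma ascent_seq_001_structure:
  assumes "ascent_seq w" and "\<not> contains_pattern w [0, 0, 1]"
  shows "\<exists>m t. w = [0..<Suc m] @ t \<and> sorted_wrt (\<ge>) (m # t)"
proof -
  have "w \<noteq> []" using assms by (simp add: ascent_seq_def)
  then show ?thesis using assms
  proof (induction w rule: rev_nonempty_induct)
    case (single x)
    then have "[x] = [0..<Suc 0] @ []" by (simp add: ascent_seq_def)
    then show ?case by (metis sorted_wrt1)
  next
    case (snoc x w)
    have "\<not> contains_pattern w [0, 0, 1]"
      using snoc.prems(2) unfolding contains_001_iff by (blast intro: subseq_rev_drop_many)
    with snoc obtain m t where w: "w = [0..<Suc m] @ t" and t: "sorted_wrt (\<ge>) (m # t)"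
      by (auto simp: ascent_seq_snoc)
    have "x \<le> asc w + 1" using snoc by (simp add: ascent_seq_snoc)
    then have x: "x \<le> Suc m" using asc_upt_append[OF t] w by simp
    show ?case
    \<comment> \<open>While \<open>t\<close> is empty, \<open>x\<close> may still extend the run;
      once \<open>t\<close> has a letter, the run is closed.\<close>
    proof (cases t rule: rev_cases)
      case Nil
      show ?thesis
      proof (cases "x = Suc m")
        case True
        with w Nil have "w @ [x] = [0..<Suc (Suc m)] @ []" by simp
        then show ?thesis by (metis sorted_wrt1)
      next
        case False
        with x w Nil show ?thesis by (intro exI[of _ m] exI[of _ "[x]"]) auto
      qed
    next
      case (snoc s y)
      \<comment> \<open>The last letter \<open>y\<close> of \<open>t\<close> already occurs in the
        run, so \<open>x > y\<close> would complete y, y, x to a 001.\<close>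
      have "y \<le> m" using t snoc by (auto simp: sorted_wrt_append)
      then have "subseq [y] [0..<Suc m]" by (subst subseq_singleton_left) auto
      moreover have "subseq [y, x] (t @ [x])" using snoc
        by (simp add: list_emb_append2)
      ultimately have "subseq ([y] @ [y, x]) ([0..<Suc m] @ (t @ [x]))"
        by (rule list_emb_append_mono)
      then have "x \<le> y"
        using \<open>\<not> contains_pattern (w @ [x]) [0, 0, 1]\<close> w
        unfolding contains_001_iff by (auto simp: not_less[symmetric] simp del: upt_Suc)
      with t snoc have "sorted_wrt (\<ge>) (m # t @ [x])"
        by (fastforce simp: sorted_wrt_append)
      with w show ?thesis by (intro exI[of _ m] exI[of _ "t @ [x]"]) simp
    qed
  qed
qed

text \<open>The second hypothesis is avoidance of 210 with the \<open>m\<close> of the initial run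
  as top letter. Fixing \<open>y = m\<close> for an empty last block gives that case a single
  code.\<close>

lemma decreasing_two_blocks:
  fixes m :: nat
  assumes "sorted_wrt (\<ge>) (m # t)" and "\<And>a b. a < b \<Longrightarrow> b < m \<Longrightarrow> \<not> subseq [b, a] t"
  shows "\<exists>i j y. t = replicate i m @ replicate j y \<and> (j = 0 \<and> y = m \<or> 0 < j \<and> y < m)"
  using assms
proof (induction t)
  case Nil
  then show ?case by simp
next
  case (Cons x t)
  show ?case
  proof (cases "x = m")
    case True
    have "\<exists>i j y. t = replicate i m @ replicate j y \<and> (j = 0 \<and> y = m \<or> 0 < j \<and> y < m)"
    proof (rule Cons.IH)
      show "sorted_wrt (\<ge>) (m # t)" using Cons.prems(1) by simp
      show "\<not> subseq [b, a] t" if "a < b" "b < m" for a b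
        using Cons.prems(2)[OF that] list_emb_Cons by blast
    qed
    then obtain i j y where "t = replicate i m @ replicate j y"
      "j = 0 \<and> y = m \<or> 0 < j \<and> y < m" by blast
    with True show ?thesis by (intro exI[of _ "Suc i"] exI[of _ j] exI[of _ y]) simp
  next
    case False
    with Cons.prems have "x < m" by simp
    have "z = x" if "z \<in> set t" for z
    proof (rule ccontr)
      assume "z \<noteq> x"
      with that Cons.prems(1) have "z < x" by force
      moreover have "subseq [x, z] (x # t)" using that by (simp add: subseq_singleton_left)
      ultimately show False using Cons.prems(2) \<open>x < m\<close> by blast
    qed
    then have "t = replicate (length t) x" by (simp add: replicate_length_same)
    then have "x # t = replicate 0 m @ replicate (Suc (length t)) x" by simp
    with \<open>x < m\<close> show ?thesis by blast
  qed
qed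

section \<open>Two-block words and their count\<close>

definition two_block_word :: "nat \<Rightarrow> nat \<Rightarrow> nat \<Rightarrow> nat \<Rightarrow> nat list" where
  "two_block_word m i j y = [0..<Suc m] @ replicate i m @ replicate j y"

lemma sorted_wrt_replicate: "P x x \<Longrightarrow> sorted_wrt P (replicate n x)"
  by (simp add: sorted_wrt_iff_nth_less)

lemma decreasing_blocks: "y \<le> m \<Longrightarrow> sorted_wrt (\<ge>) (m # replicate i m @ replicate j (y::nat))"
  by (auto simp: sorted_wrt_append sorted_wrt_replicate)

text \<open>The strictly increasing run cannot hold both copies of \<open>a\<close>; so the second
  copy and \<open>b\<close> lie in the weakly decreasing tail, against \<open>a < b\<close>.\<close>

lemma two_block_word_avoids_001:
  assumes "y \<le> m"
  shows "\<not> contains_pattern (two_block_word m i j y) [0, 0, 1]"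
proof
  define t where "t = replicate i m @ replicate j y"
  assume "contains_pattern (two_block_word m i j y) [0, 0, 1]"
  then obtain a b where "a < b" and "subseq [a, a, b] ([0..<Suc m] @ t)"
    unfolding contains_001_iff two_block_word_def t_def by blast
  then obtain u v where uv: "[a, a, b] = u @ v" and u: "subseq u [0..<Suc m]" and v: "subseq v t"
    unfolding subseq_append_iff by blast
  have du: "sorted_wrt (<) u" using u by (rule sorted_wrt_subseq) (rule sorted_wrt_upt)
  have dv: "sorted_wrt (\<ge>) v" using decreasing_blocks[OF assms, of i j]
    by (intro sorted_wrt_subseq[OF v]) (simp add: t_def)
  show False using uv du dv \<open>a < b\<close> by (auto simp: Cons_eq_append_conv)
qed

text \<open>Cut before the last block: a weakly increasing part and a constant part can each take at
  most one letter of a strictly decreasing triple.\<close>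

lemma two_block_word_avoids_210:
  "\<not> contains_pattern (two_block_word m i j y) [2, 1, 0]"
proof
  define s where "s = [0..<Suc m] @ replicate i m"
  assume "contains_pattern (two_block_word m i j y) [2, 1, 0]"
  then obtain a b c where less: "a < b" "b < c" and "subseq [c, b, a] (s @ replicate j y)"
    unfolding contains_210_iff two_block_word_def s_def by auto
  then obtain u v where uv: "[c, b, a] = u @ v" and u: "subseq u s" and v: "subseq v (replicate j y)"
    unfolding subseq_append_iff by blast
  have "sorted_wrt (\<le>) s"
    by (auto simp: s_def sorted_wrt_append sorted_wrt_replicate simp del: upt_Suc)
  with u have du: "sorted_wrt (\<le>) u" by (rule sorted_wrt_subseq)
  have dv: "sorted_wrt (=) v" 
    by (rule sorted_wrt_subseq[OF v]) (simp add: sorted_wrt_replicate)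
  show False using uv du dv less by (auto simp: Cons_eq_append_conv)
qed

text \<open>A pair \<open>(j, y)\<close> records the length and letter of the last block; the total
  length then forces \<open>n - m - j\<close> extra copies of \<open>m\<close>. The pair
  \<open>(0, m)\<close> stands for an empty last block.\<close>

lemma ascent_avoiders_001_210:
  assumes "m \<le> n"
  shows "ascent_avoiders {[0, 0, 1], [2, 1, 0]} (int n + 1) (int m) =
    (\<lambda>(j, y). two_block_word m (n - m - j) j y) ` insert (0, m) ({1..n - m} \<times> {..<m})"
    (is "?A = ?f ` ?S")
proof (intro equalityI subsetI)
  fix w assume "w \<in> ?A"
  then have w: "ascent_seq w" "length w = n + 1" "\<not> contains_pattern w [0, 0, 1]"
    "\<not> contains_pattern w [2, 1, 0]" "asc w = m"
    by (auto simp: ascent_avoiders_def)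
  from ascent_seq_001_structure[OF w(1,3)] obtain m' t
    where wt: "w = [0..<Suc m'] @ t" and t: "sorted_wrt (\<ge>) (m' # t)" by blast
  have m': "m' = m" using asc_upt_append[OF t] w(5) wt by simp
  have "\<not> subseq [b, a] t" if "a < b" "b < m" for a b
  proof
    assume "subseq [b, a] t"
    moreover have "subseq [m] [0..<Suc m]" by (subst subseq_singleton_left) auto
    ultimately have "subseq ([m] @ [b, a]) ([0..<Suc m] @ t)"
      by (intro list_emb_append_mono)
    with that w(4) show False unfolding contains_210_iff wt m' by auto
  qed
  from decreasing_two_blocks[OF t[unfolded m'] this] obtain i j y
    where ij: "t = replicate i m @ replicate j y" "j = 0 \<and> y = m \<or> 0 < j \<and> y < m" by blast
  have "i + j = n - m" using w(2) wt m' ij(1) by simp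
  then have "w = ?f (j, y)" "(j, y) \<in> ?S"
    using wt m' ij by (auto simp: two_block_word_def)
  then show "w \<in> ?f ` ?S" by blast
next
  fix w assume "w \<in> ?f ` ?S"
  then obtain j y where w: "w = two_block_word m (n - m - j) j y" and "j \<le> n - m" and y: "y \<le> m"
    by fastforce
  have "length w = n + 1" using \<open>j \<le> n - m\<close> assms by (simp add: w two_block_word_def)
  moreover have "asc w = m" "ascent_seq w"
    using asc_upt_append ascent_seq_upt_append decreasing_blocks[OF y]
    unfolding w two_block_word_def by blast+
  ultimately show "w \<in> ?A"
    using two_block_word_avoids_001[OF y] two_block_word_avoids_210
    by (auto simp: ascent_avoiders_def w)
qed

lemma inj_on_two_block_word:
  "inj_on (\<lambda>(j, y). two_block_word m (n - m - j) j y) (insert (0, m) ({1..n - m} \<times> {..<m}))"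
proof (rule inj_on_inverseI)
  fix p assume p: "p \<in> insert (0, m) ({1..n - m} \<times> {..<m})"
  obtain j y where [simp]: "p = (j, y)" by (cases p)
  have last: "last ([0..<Suc m] @ replicate i m) = m" for i
    by (cases "i = 0") (simp_all del: upt_Suc)
  \<comment> \<open>A left inverse: past the run, the letters other than \<open>m\<close> number
    \<open>j\<close>, and the last letter is \<open>y\<close>. This covers \<open>(0, m)\<close>
    too, as the word then ends in \<open>m\<close>.\<close>
  let ?g = "\<lambda>w. (length (filter (\<lambda>x. x \<noteq> m) (drop (Suc m) w)), last w)"
  show "?g ((\<lambda>(j, y). two_block_word m (n - m - j) j y) p) = p"
    using p last by (auto simp: two_block_word_def simp del: upt_Suc)
qed

theorem theorem16:
  fixes n k :: int
  shows "of_nat (card (ascent_avoiders {[0, 0, 1], [2, 1, 0]} (n + 1) k)) = rascal n k"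
proof (cases "0 \<le> k \<and> k \<le> n")
  case True
  then obtain m N where k: "k = int m" and n: "n = int N" and "m \<le> N"
    using that[of "nat k" "nat n"] by (simp add: nat_mono)
  have "card (ascent_avoiders {[0, 0, 1], [2, 1, 0]} (n + 1) k) =
      card (insert (0, m) ({1..N - m} \<times> {..<m}))"
    unfolding k n ascent_avoiders_001_210[OF \<open>m \<le> N\<close>]
    by (rule card_image) (rule inj_on_two_block_word)
  \<comment> \<open>The pair \<open>(0, m)\<close> lies outside the product and contributes the
    1.\<close>
  also have "\<dots> = m * (N - m) + 1" by (simp add: card_insert_if)
  finally show ?thesis
    using rascal_closed_form[of k n] True \<open>m \<le> N\<close> by (simp add: k n of_nat_diff)
next
  case False
  \<comment> \<open>A nonempty word has fewer ascents than letters, so length \<open>n + 1\<close>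
    forces \<open>k\<close> into the range from 0 to \<open>n\<close>.\<close>
  have "w \<notin> ascent_avoiders {[0, 0, 1], [2, 1, 0]} (n + 1) k" for w
    using False asc_less_length[of w] by (auto simp: ascent_avoiders_def ascent_seq_def)
  then have "ascent_avoiders {[0, 0, 1], [2, 1, 0]} (n + 1) k = {}" by blast
  then show ?thesis using False rascal_eq_0[of n k] by auto
qed

end
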